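(* Let $m,n$ be positive integers and let $\mathcal{S}\in F(m,n,3)$ be an f-diagonal tensor. Then $\mathcal{S}\in S(m,n,3)$ if and only if all of the following hold: (a) $\mathcal{S}(i,i,2)=\mathcal{S}(i,i,3)$ for $i=1,2,\dots,\min\{m,n\}$; (b) $\mathcal{S}(i,i,1)\ge\max\{-2\mathcal{S}(i,i,2),\ \mathcal{S}(i,i,2)\}$ for $i=1,2,\dots,\min\{m,n\}$; (c) $\mathcal{S}(i,i,1)-\mathcal{S}(i+1,i+1,1)\ge\max\{-2[\mathcal{S}(i,i,2)-\mathcal{S}(i+1,i+1,2)],\ \mathcal{S}(i,i,2)-\mathcal{S}(i+1,i+1,2)\}$ for $i=1,2,\dots,\min\{m,n\}-1$.
   Context: Let $T(m,n,p)$ be the real linear space of $m\times n\times p$ real tensors; $\mathcal{A}(i,j,k)$ denotes the entries of $\mathcal{A}\in T(m,n,p)$ and $A^{(k)}=\mathcal{A}(:,:,k)\in\mathbb{R}^{m\times n}$ its frontal slices, $k=1,\dots,p$. A tensor is f-diagonal if all its frontal slices are (rectangular) diagonal matrices; $F(m,n,p)$ is the set of f-diagonal tensors in $T(m,n,p)$. Kilmer-Martin mapping $G:T(m,n,p)\to F(m,n,p)$. Let $\omega=e^{2\pi\sqrt{-1}/p}$. For $\mathcal{A}\in T(m,n,p)$ and $k=1,\dots,p$ put $\Delta^{(k)}(\mathcal{A})=\sum_{l=1}^p\omega^{(l-1)(k-1)}A^{(l)}\in\mathbb{C}^{m\times n}$, and let $\mathcal{D}(i,i,k)$, $i=1,\dots,\min\{m,n\}$,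 be the singular values of $\Delta^{(k)}(\mathcal{A})$ in nonincreasing order (counted with multiplicity). Then $\mathcal{S}=G(\mathcal{A})$ is the f-diagonal tensor with $\mathcal{S}(i,i,k)=\frac1p\sum_{l=1}^p\bar\omega^{(k-1)(l-1)}\mathcal{D}(i,i,l)$ for $i=1,\dots,\min\{m,n\}$, $k=1,\dots,p$ (these numbers are real). A tensor $\mathcal{S}\in F(m,n,p)$ is called s-diagonal if there is some $\mathcal{A}\in T(m,n,p)$ with $G(\mathcal{A})=\mathcal{S}$; $S(m,n,p)$ denotes the set of all s-diagonal tensors in $F(m,n,p)$. Here $p=3$. *)

theory Defs
  imports
    Complex_Main
    "HOL-Computational_Algebra.Computational_Algebra"
    "Jordan_Normal_Form.Schur_Decomposition"
begin

text \<open>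
  An \<open>m \<times> n \<times> p\<close> tensor is a function of three indices counted from \<open>1\<close>. Requiring it to
  vanish outside the index box makes equality of tensors the same as equality of functions.
\<close>

type_synonym tensor = "nat \<Rightarrow> nat \<Rightarrow> nat \<Rightarrow> real"

definition tensors :: "nat \<Rightarrow> nat \<Rightarrow> nat \<Rightarrow> tensor set" where
  "tensors m n p =
     {A. \<forall>i j k. \<not> (i \<in> {1..m} \<and> j \<in> {1..n} \<and> k \<in> {1..p}) \<longrightarrow> A i j k = 0}"

text \<open>Matrices of type \<^typ>\<open>'a mat\<close> count rows and columns from \<open>0\<close>, hence the index shift.\<close>

definition frontal_slice :: "nat \<Rightarrow> nat \<Rightarrow> tensor \<Rightarrow> nat \<Rightarrow> real mat" where
  "frontal_slice m n A k = mat m n (\<lambda>(i, j). A (i + 1) (j + 1) k)"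

definition f_diagonal_tensors :: "nat \<Rightarrow> nat \<Rightarrow> nat \<Rightarrow> tensor set" where
  "f_diagonal_tensors m n p =
     {A \<in> tensors m n p. \<forall>k \<in> {1..p}. diagonal_mat (frontal_slice m n A k)}"

text \<open>
  The singular values of \<open>M\<close> are the square roots of the eigenvalues of \<open>M\<^sup>* M\<close>, counted with
  algebraic multiplicity as roots of the characteristic polynomial. If \<open>M\<close> has more columns than
  rows, \<open>M\<^sup>* M\<close> has surplus zero eigenvalues, which are cut off at the end of the nonincreasing
  list. The eigenvalues are nonnegative reals, so taking \<^const>\<open>Re\<close> only changes the type.
\<close>

definition singular_values :: "complex mat \<Rightarrow> real list" where
  "singular_values M =
     take (min (dim_row M) (dim_col M))
       (rev (sorted_list_of_multiset
          (image_mset (\<lambda>z. sqrt (Re z)) (proots (char_poly (mat_adjoint M * M))))))"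

definition root_of_unity :: "nat \<Rightarrow> complex" where
  "root_of_unity p = exp (2 * complex_of_real pi * \<i> / of_nat p)"

definition fourier_slice :: "nat \<Rightarrow> nat \<Rightarrow> nat \<Rightarrow> tensor \<Rightarrow> nat \<Rightarrow> complex mat" where
  "fourier_slice m n p A k =
     mat m n (\<lambda>(i, j). \<Sum>l = 1..p. root_of_unity p ^ ((l - 1) * (k - 1)) *
                          complex_of_real (frontal_slice m n A l $$ (i, j)))"

definition fourier_singular_value ::
    "nat \<Rightarrow> nat \<Rightarrow> nat \<Rightarrow> tensor \<Rightarrow> nat \<Rightarrow> nat \<Rightarrow> real" where
  "fourier_singular_value m n p A i k = singular_values (fourier_slice m n p A k) ! (i - 1)"

text \<open>
  The Kilmer-Martin mapping. The complex sum is real because \<open>A\<close> is: for \<open>l \<ge> 2\<close> the slices \<open>l\<close>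
  and \<open>p + 2 - l\<close> of its Fourier transform are complex conjugates and have the same singular
  values. So \<^const>\<open>Re\<close> only changes the type here, too.
\<close>

definition kilmer_martin :: "nat \<Rightarrow> nat \<Rightarrow> nat \<Rightarrow> tensor \<Rightarrow> tensor" where
  "kilmer_martin m n p A = (\<lambda>i j k.
     if i = j \<and> i \<in> {1..min m n} \<and> k \<in> {1..p}
     then Re (1 / of_nat p *
            (\<Sum>l = 1..p. cnj (root_of_unity p) ^ ((k - 1) * (l - 1)) *
                         complex_of_real (fourier_singular_value m n p A i l)))
     else 0)"

definition s_diagonal_tensors :: "nat \<Rightarrow> nat \<Rightarrow> nat \<Rightarrow> tensor set" where
  "s_diagonal_tensors m n p =
     {S \<in> f_diagonal_tensors m n p. \<exists>A \<in> tensors m n p. kilmer_martin m n p A = S}"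

end

theory Submission
  imports Defs
begin

text \<open>
  Write \<open>d\<^sub>1, d\<^sub>2, d\<^sub>3\<close> for the singular values of the three Fourier slices at position \<open>i\<close>. The real
  part of the Kilmer-Martin formula gives \<open>S i i 1 + 2 * S i i 2 = d\<^sub>1\<close> and
  \<open>S i i 1 - S i i 2 = (d\<^sub>2 + d\<^sub>3) / 2\<close>, so the inequalities hold because singular values are
  nonnegative and nonincreasing. Conversely, the Fourier slices of an \<open>S\<close> satisfying the
  conditions are already diagonal with nonnegative nonincreasing diagonals, so \<open>S\<close> is a fixed
  point of the Kilmer-Martin mapping.
\<close>

section \<open>Roots of polynomials and adjoint matrices\<close>

lemma proots_prod_linear_factors:
  fixes as :: "'a :: idom list"
  shows "proots (\<Prod>a\<leftarrow>as. [:- a, 1:]) = mset as"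
proof (induction as)
  case (Cons a as)
  \<comment> \<open>Additivity of \<open>proots\<close> over a product requires nonzero
    factors.\<close>
  have "0 \<notin> (\<lambda>a. [:- a, 1:]) ` set as"
    by auto
  then have "(\<Prod>a\<leftarrow>as. [:- a, 1:]) \<noteq> 0"
    by (simp only: prod_list_zero_iff set_map not_False_eq_True)
  then have "proots ([:- a, 1:] * (\<Prod>a\<leftarrow>as. [:- a, 1:]))
      = proots [:- a, 1:] + proots (\<Prod>a\<leftarrow>as. [:- a, 1:])"
    by (intro proots_mult) simp_all
  then show ?case
    by (simp only: list.map prod_list.Cons Cons.IH proots_linear_factor) simp
qed simp

lemma dim_row_mat_adjoint [simp]: "dim_row (mat_adjoint A) = dim_col A"
  and dim_col_mat_adjoint [simp]: "dim_col (mat_adjoint A) = dim_row A"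
  by (simp_all add: mat_adjoint_def)

lemma index_mat_adjoint [simp]:
  assumes "i < dim_col A" and "j < dim_row A"
  shows "mat_adjoint A $$ (i, j) = conjugate (A $$ (j, i))"
  using assms by (simp add: mat_adjoint_def mat_of_rows_index)

lemma mat_adjoint_carrier [simp, intro]:
  "A \<in> carrier_mat m n \<Longrightarrow> mat_adjoint A \<in> carrier_mat n m"
  by auto

lemma mat_adjoint_cscalar_prod:
  fixes A :: "complex mat"
  assumes A: "A \<in> carrier_mat m n" and u: "u \<in> carrier_vec m" and v: "v \<in> carrier_vec n"
  shows "(mat_adjoint A *\<^sub>v u) \<bullet>c v = u \<bullet>c (A *\<^sub>v v)"
proof -
  have "(mat_adjoint A *\<^sub>v u) \<bullet>c v
      = (\<Sum>j<n. (\<Sum>i<m. cnj (A $$ (i, j)) * u $ i) * cnj (v $ j))"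
    using A u v by (auto simp: scalar_prod_def atLeast0LessThan intro!: sum.cong)
  also have "\<dots> = (\<Sum>i<m. u $ i * cnj (\<Sum>j<n. A $$ (i, j) * v $ j))"
    by (simp add: sum_distrib_left sum_distrib_right, subst sum.swap, simp add: ac_simps)
  also have "\<dots> = u \<bullet>c (A *\<^sub>v v)"
    using A u v by (auto simp: scalar_prod_def atLeast0LessThan intro!: sum.cong)
  finally show ?thesis .
qed

text \<open>For an eigenvector \<open>v\<close> and \<open>u = A *\<^sub>v v\<close>, moving the
  adjoint across the inner product gives \<open>z * (v \<bullet>c v) = u \<bullet>c u\<close>, where
  \<open>v \<bullet>c v\<close> is positive. This makes the square roots in
  \<open>singular_values\<close> nonnegative.\<close>

lemma eigenvalue_gram_nonneg:
  fixes A :: "complex mat"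
  assumes "eigenvalue (mat_adjoint A * A) z"
  shows "0 \<le> Re z"
proof -
  define m n where "m = dim_row A" and "n = dim_col A"
  have A: "A \<in> carrier_mat m n"
    by (simp add: m_def n_def)
  obtain v where v: "v \<in> carrier_vec n" "v \<noteq> 0\<^sub>v n"
    and eig: "mat_adjoint A * A *\<^sub>v v = z \<cdot>\<^sub>v v"
    using assms by (auto simp: eigenvalue_def eigenvector_def n_def)
  define u where "u = A *\<^sub>v v"
  have u: "u \<in> carrier_vec m"
    using A v by (simp add: u_def)
  have "z * (v \<bullet>c v) = (z \<cdot>\<^sub>v v) \<bullet>c v"
    using v by simp
  also have "z \<cdot>\<^sub>v v = mat_adjoint A *\<^sub>v u"
    using assoc_mult_mat_vec[OF mat_adjoint_carrier[OF A] A v(1)] by (simp add: u_def flip: eig)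
  also have "\<dots> \<bullet>c v = u \<bullet>c u"
    using mat_adjoint_cscalar_prod[OF A u v(1)] by (simp add: u_def)
  finally have eq: "z * (v \<bullet>c v) = u \<bullet>c u" .
  have pos: "Re (v \<bullet>c v) > 0" "Im (v \<bullet>c v) = 0"
    using conjugate_square_greater_0_vec[OF v(1)] v(2) by (auto simp: less_complex_def)
  have "Re z * Re (v \<bullet>c v) = Re (u \<bullet>c u)"
    using arg_cong[OF eq, of Re] pos by simp
  also have "\<dots> \<ge> 0"
    using conjugate_square_ge_0_vec[of u] by (auto simp: less_eq_complex_def)
  finally show ?thesis
    using pos(1) by (simp add: zero_le_mult_iff)
qed

section \<open>Singular values\<close>

text \<open>A complex polynomial has as many roots as its degree, here \<open>dim_col A\<close>, so
  \<open>take\<close> always finds enough entries. This keeps later list accesses in range.\<close>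

lemma length_singular_values [simp]:
  "length (singular_values A) = min (dim_row A) (dim_col A)"
proof -
  have "mat_adjoint A * A \<in> carrier_mat (dim_col A) (dim_col A)"
    by (rule carrier_matI) simp_all
  then have "degree (char_poly (mat_adjoint A * A)) = dim_col A"
    by (rule degree_monic_char_poly[THEN conjunct1])
  moreover have "length (sorted_list_of_multiset M) = size M" for M :: "real multiset"
    by (metis mset_sorted_list_of_multiset size_mset)
  ultimately show ?thesis
    by (simp add: singular_values_def size_proots_complex)
qed

lemma singular_values_nonneg:
  assumes "x \<in> set (singular_values A)"
  shows "0 \<le> x"
proof -
  have carrier: "mat_adjoint A * A \<in> carrier_mat (dim_col A) (dim_col A)"
    by auto
  have "char_poly (mat_adjoint A * A) \<noteq> 0"
    using degree_monic_char_poly[OF carrier] by auto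
  moreover obtain z where "z \<in># proots (char_poly (mat_adjoint A * A))" "x = sqrt (Re z)"
    using assms by (auto simp: singular_values_def dest!: in_set_takeD)
  ultimately show ?thesis
    using eigenvalue_root_char_poly[OF carrier] eigenvalue_gram_nonneg[of A z] by auto
qed

lemma sorted_singular_values: "sorted_wrt (\<ge>) (singular_values A)"
  unfolding singular_values_def by (intro sorted_wrt_take) (simp add: sorted_wrt_rev)

text \<open>The Gram matrix is diagonal with the squares of the entries, so its roots can be read
  off, and the assumed order means that sorting only reverses the list.\<close>

lemma singular_values_diagonal:
  fixes d :: "nat \<Rightarrow> real"
  assumes nonneg: "\<And>i. i < min m n \<Longrightarrow> 0 \<le> d i"
    and antimono: "\<And>i j. i \<le> j \<Longrightarrow> j < min m n \<Longrightarrow> d j \<le> d i"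
  shows "singular_values (mat m n (\<lambda>(i, j). if i = j then complex_of_real (d i) else 0))
    = map d [0..<min m n]"
proof -
  define A where "A = mat m n (\<lambda>(i, j). if i = j then complex_of_real (d i) else 0)"
  \<comment> \<open>Padding \<open>d\<close> with zeros accounts for the surplus zero eigenvalues
    when \<open>n > m\<close>.\<close>
  define e where "e j = (if j < m then d j else 0)" for j
  have gram: "mat_adjoint A * A = mat n n (\<lambda>(i, j). if i = j then of_real ((e i)\<^sup>2) else 0)"
    (is "_ = ?D")
  proof (rule eq_matI)
    fix i j assume "i < dim_row ?D" "j < dim_col ?D"
    then have ij: "i < n" "j < n" by simp_all
    have "(mat_adjoint A * A) $$ (i, j)
        = (\<Sum>k<m. cnj (if k = i then of_real (d k) else 0) * (if k = j then of_real (d k) else 0))"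
      using ij by (auto simp: A_def scalar_prod_def atLeast0LessThan intro!: sum.cong)
    \<comment> \<open>In this form the sum collapses to the term \<open>k = i\<close>; for
      \<open>i \<ge> m\<close> no such term occurs, which matches \<open>e i = 0\<close>.\<close>
    also have "\<dots> = (\<Sum>k<m. if k = i then (if i = j then of_real ((d i)\<^sup>2) else 0) else 0)"
      by (intro sum.cong) (auto simp: power2_eq_square)
    also have "\<dots> = ?D $$ (i, j)"
      using ij by (simp add: e_def)
    finally show "(mat_adjoint A * A) $$ (i, j) = ?D $$ (i, j)" .
  qed (simp_all add: A_def)
  have "char_poly ?D = (\<Prod>a\<leftarrow>diag_mat ?D. [:- a, 1:])"
    by (rule char_poly_upper_triangular[of _ n]) auto
  also have "diag_mat ?D = map (\<lambda>i. of_real ((e i)\<^sup>2)) [0..<n]"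
    by (auto simp: diag_mat_def)
  finally have "proots (char_poly ?D) = mset (map (\<lambda>i. of_real ((e i)\<^sup>2)) [0..<n])"
    by (simp only: proots_prod_linear_factors)
  then have "image_mset (\<lambda>z. sqrt (Re z)) (proots (char_poly ?D))
      = mset (map (\<lambda>i. sqrt ((e i)\<^sup>2)) [0..<n])"
    by (simp add: image_mset.compositionality o_def flip: of_real_power)
  also have "map (\<lambda>i. sqrt ((e i)\<^sup>2)) [0..<n] = map e [0..<n]"
    using nonneg by (auto simp: e_def)
  finally have roots: "image_mset (\<lambda>z. sqrt (Re z)) (proots (char_poly ?D)) = mset (map e [0..<n])" .
  \<comment> \<open>Zeros placed after nonnegative entries keep the list nonincreasing.\<close>
  have "sorted_wrt (\<ge>) (map e [0..<n])"
    using antimono nonneg by (auto simp: sorted_wrt_iff_nth_less e_def)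
  then have "sorted (rev (map e [0..<n]))"
    by (simp add: sorted_wrt_rev)
  then have "sort (map e [0..<n]) = rev (map e [0..<n])"
    by (intro properties_for_sort) simp_all
  then have "rev (sorted_list_of_multiset (mset (map e [0..<n]))) = map e [0..<n]"
    by (simp only: sorted_list_of_multiset_mset rev_rev_ident)
  then have "singular_values A = take (min m n) (map e [0..<n])"
    unfolding singular_values_def gram roots
    by (simp only: A_def dim_row_mat dim_col_mat)
  also have "\<dots> = map d [0..<min m n]"
    by (auto intro!: nth_equalityI simp: e_def)
  finally show ?thesis
    by (simp add: A_def)
qed

lemma fourier_singular_value_nonneg:
  assumes "i \<in> {1..min m n}"
  shows "0 \<le> fourier_singular_value m n p A i k"
  unfolding fourier_singular_value_def
  by (rule singular_values_nonneg, rule nth_mem) (use assms in \<open>auto simp: fourier_slice_def\<close>)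

lemma fourier_singular_value_antimono:
  assumes "i \<in> {1..min m n - 1}"
  shows "fourier_singular_value m n p A (i + 1) k \<le> fourier_singular_value m n p A i k"
proof -
  \<comment> \<open>The one-based positions \<open>i\<close> and \<open>i + 1\<close> are the list
    positions \<open>i - 1\<close> and \<open>i\<close>.\<close>
  have "i - 1 < i" "i < length (singular_values (fourier_slice m n p A k))"
    using assms by (auto simp: fourier_slice_def)
  from sorted_wrt_nth_less[OF sorted_singular_values this] show ?thesis
    by (simp add: fourier_singular_value_def)
qed

section \<open>The transform for three frontal slices\<close>

lemma root_of_unity_3 [simp]:
  "Re (root_of_unity 3) = - (1 / 2)" "Im (root_of_unity 3) = sqrt 3 / 2"
proof -
  have "root_of_unity 3 = cis (2 * pi / 3)"
    by (simp add: root_of_unity_def cis_conv_exp ac_simps)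
  then show "Re (root_of_unity 3) = - (1 / 2)" "Im (root_of_unity 3) = sqrt 3 / 2"
    by (simp_all add: cos_120 sin_120)
qed

text \<open>For \<open>p = 3\<close> the exponents \<open>(l - 1) * (k - 1)\<close> are 0, 1, 2 and
  4; this and the next lemma treat the last two.\<close>

lemma root_of_unity_3_power2 [simp]: "root_of_unity 3 ^ 2 = cnj (root_of_unity 3)"
  by (simp add: complex_eq_iff power2_eq_square)

lemma root_of_unity_3_power4 [simp]: "root_of_unity 3 ^ 4 = root_of_unity 3"
proof -
  have "root_of_unity 3 ^ 4 = (root_of_unity 3 ^ 2) ^ 2"
    by (simp flip: power_mult del: root_of_unity_3_power2)
  then show ?thesis
    by (simp flip: complex_cnj_power)
qed

text \<open>The lower bound is \<open>Suc 0\<close> because the simplifier turns \<open>1\<close>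
  into it.\<close>

lemma sum_1_3: "sum f {Suc 0..3} = f 1 + f 2 + f (3 :: nat)"
proof -
  have "{Suc 0..3} = {1, 2, 3}"
    by auto
  then show ?thesis
    by (simp add: add.assoc)
qed

text \<open>Both nontrivial cube roots of unity have real part -1/2, so the second and third
  formulas agree, which yields condition (a).\<close>

lemma kilmer_martin_3:
  fixes A :: tensor
  assumes "i \<in> {1..min m n}"
  defines "d \<equiv> fourier_singular_value m n 3 A i"
  shows "kilmer_martin m n 3 A i i 1 = (d 1 + d 2 + d 3) / 3"
    and "kilmer_martin m n 3 A i i 2 = (d 1 - (d 2 + d 3) / 2) / 3"
    and "kilmer_martin m n 3 A i i 3 = (d 1 - (d 2 + d 3) / 2) / 3"
  using assms(1)
  by (simp_all add: kilmer_martin_def sum_1_3 add_divide_distrib flip: d_def complex_cnj_power)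

lemma f_diagonal_tensors_eq_0:
  assumes S: "S \<in> f_diagonal_tensors m n p"
    and outside: "\<not> (i = j \<and> i \<in> {1..min m n} \<and> k \<in> {1..p})"
  shows "S i j k = 0"
proof (cases "i \<in> {1..m} \<and> j \<in> {1..n} \<and> k \<in> {1..p}")
  case True
  \<comment> \<open>Both indices are at least 1, so truncated subtraction keeps them
    distinct.\<close>
  then have *: "diagonal_mat (frontal_slice m n S k)" "i - 1 < m" "j - 1 < n" "i - 1 \<noteq> j - 1"
    using S outside by (auto simp: f_diagonal_tensors_def)
  then have "frontal_slice m n S k $$ (i - 1, j - 1) = 0"
    by (simp add: diagonal_mat_def frontal_slice_def)
  with True * show ?thesis
    by (simp add: frontal_slice_def)
next
  case False
  with S show ?thesis
    by (auto simp: f_diagonal_tensors_def tensors_def)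
qed

text \<open>Slices 2 and 3 agree on the diagonal, so their coefficients add up: to 2 for
  \<open>k = 1\<close>, and otherwise to the sum -1 of the two nontrivial roots of unity.\<close>

lemma fourier_slice_3_f_diagonal:
  assumes S: "S \<in> f_diagonal_tensors m n 3"
    and eq: "\<And>i. i \<in> {1..min m n} \<Longrightarrow> S i i 2 = S i i 3"
    and k: "k \<in> {1..3}"
  shows "fourier_slice m n 3 S k = mat m n (\<lambda>(i, j). if i = j
    then complex_of_real (if k = 1 then S (i + 1) (i + 1) 1 + 2 * S (i + 1) (i + 1) 2
      else S (i + 1) (i + 1) 1 - S (i + 1) (i + 1) 2) else 0)"
    (is "_ = ?D")
proof (rule eq_matI)
  fix i j assume "i < dim_row ?D" "j < dim_col ?D"
  then have ij: "i < m" "j < n" by simp_all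
  have k': "k = 1 \<or> k = 2 \<or> k = 3"
    using k by auto
  show "fourier_slice m n 3 S k $$ (i, j) = ?D $$ (i, j)"
  proof (cases "i = j")
    case True
    from ij True have "S (i + 1) (i + 1) 3 = S (i + 1) (i + 1) 2"
      by (intro eq[symmetric]) auto
    then show ?thesis
      using ij True k'
      by (elim disjE; intro complex_eqI; simp add: fourier_slice_def frontal_slice_def sum_1_3)
  next
    case False
    have "S (i + 1) (j + 1) l = 0" if "l \<in> {1..3}" for l
      by (rule f_diagonal_tensors_eq_0[OF S]) (use False in simp)
    then show ?thesis
      using ij False by (simp add: fourier_slice_def frontal_slice_def)
  qed
qed (simp_all add: fourier_slice_def)

lemma f_diagonal_tensors_eqI:
  assumes S: "S \<in> f_diagonal_tensors m n p" and T: "T \<in> f_diagonal_tensors m n p"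
    and eq: "\<And>i k. i \<in> {1..min m n} \<Longrightarrow> k \<in> {1..p} \<Longrightarrow> S i i k = T i i k"
  shows "S = T"
proof (intro ext)
  fix i j k
  show "S i j k = T i j k"
  proof (cases "i = j \<and> i \<in> {1..min m n} \<and> k \<in> {1..p}")
    case True
    with eq show ?thesis by blast
  next
    case False
    then show ?thesis
      by (simp only: f_diagonal_tensors_eq_0[OF S False] f_diagonal_tensors_eq_0[OF T False])
  qed
qed

lemma kilmer_martin_f_diagonal: "kilmer_martin m n p A \<in> f_diagonal_tensors m n p"
proof -
  have "kilmer_martin m n p A i j k = 0" if "\<not> (i = j \<and> i \<in> {1..min m n} \<and> k \<in> {1..p})" for i j k
    unfolding kilmer_martin_def using that by (simp only: if_False)
  then show ?thesis
    by (auto simp: f_diagonal_tensors_def tensors_def diagonal_mat_def frontal_slice_def)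
qed

lemma kilmer_martin_3_fixed_point:
  assumes S: "S \<in> f_diagonal_tensors m n 3"
    and eq: "\<And>i. i \<in> {1..min m n} \<Longrightarrow> S i i 2 = S i i 3"
    and nonneg: "\<And>i. i \<in> {1..min m n} \<Longrightarrow> S i i 1 \<ge> max (- 2 * S i i 2) (S i i 2)"
    and step: "\<And>i. i \<in> {1..min m n - 1} \<Longrightarrow> S i i 1 - S (i + 1) (i + 1) 1
      \<ge> max (- 2 * (S i i 2 - S (i + 1) (i + 1) 2)) (S i i 2 - S (i + 1) (i + 1) 2)"
  shows "kilmer_martin m n 3 S = S"
proof (rule f_diagonal_tensors_eqI[OF kilmer_martin_f_diagonal S])
  fix i k :: nat assume i: "i \<in> {1..min m n}" and k: "k \<in> {1..3}"
  \<comment> \<open>These are the diagonals of the Fourier slices, indexed from 0. In each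
    \<open>max\<close>, the first argument controls \<open>k = 1\<close> and the second controls the
    other slices.\<close>
  define d where "d k i = (if k = 1 then S (i + 1) (i + 1) 1 + 2 * S (i + 1) (i + 1) 2
    else S (i + 1) (i + 1) 1 - S (i + 1) (i + 1) 2)" for k i :: nat
  have d_nonneg: "0 \<le> d l j" if "j < min m n" for l j
    using nonneg[of "j + 1"] that by (auto simp: d_def)
  have d_step: "d l (Suc j) \<le> d l j" if "Suc j < min m n" for l j
  proof -
    have "j + 1 \<in> {1..min m n - 1}"
      using that by auto
    from step[OF this] show ?thesis
      by (auto simp: d_def)
  qed
  have d_antimono: "d l j' \<le> d l j" if "j \<le> j'" "j' < min m n" for l j j'
    using that by (induction rule: dec_induct) (auto intro: order.trans[OF d_step])
  have d: "fourier_singular_value m n 3 S i l = d l (i - 1)" if "l \<in> {1..3}" for l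
  proof -
    have "fourier_slice m n 3 S l
        = mat m n (\<lambda>(i, j). if i = j then complex_of_real (d l i) else 0)"
      unfolding d_def by (rule fourier_slice_3_f_diagonal[OF S eq that])
    moreover have "i - 1 < min m n"
      using i by auto
    ultimately show ?thesis
      using singular_values_diagonal[of m n "d l", OF d_nonneg d_antimono]
      by (simp add: fourier_singular_value_def)
  qed
  have d_eq: "d 1 (i - 1) = S i i 1 + 2 * S i i 2" "d 2 (i - 1) = S i i 1 - S i i 2"
    "d 3 (i - 1) = S i i 1 - S i i 2"
    using i by (auto simp: d_def)
  consider "k = 1" | "k = 2" | "k = 3"
    using k by force
  then show "kilmer_martin m n 3 S i i k = S i i k"
    \<comment> \<open>Substituting \<open>d_eq\<close> inverts the transform. Removing
      \<open>One_nat_def\<close> keeps \<open>1\<close> intact, so that the rewrite rules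
      match.\<close>
    using eq[OF i] by cases (simp_all add: kilmer_martin_3[OF i] d d_eq diff_divide_distrib del: One_nat_def)
qed

theorem theorem7p2:
  fixes m n :: nat and S :: tensor
  assumes "m \<ge> 1" and "n \<ge> 1"
    and "S \<in> f_diagonal_tensors m n 3"
  shows "S \<in> s_diagonal_tensors m n 3 \<longleftrightarrow>
    (\<forall>i \<in> {1..min m n}. S i i 2 = S i i 3) \<and>
    (\<forall>i \<in> {1..min m n}. S i i 1 \<ge> max (- 2 * S i i 2) (S i i 2)) \<and>
    (\<forall>i \<in> {1..min m n - 1}.
       S i i 1 - S (i + 1) (i + 1) 1
         \<ge> max (- 2 * (S i i 2 - S (i + 1) (i + 1) 2)) (S i i 2 - S (i + 1) (i + 1) 2))"
  (is "?L \<longleftrightarrow> ?R")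
proof
  assume ?L
  then obtain A where A: "S = kilmer_martin m n 3 A"
    by (auto simp: s_diagonal_tensors_def)
  let ?d = "fourier_singular_value m n 3 A"
  note S = kilmer_martin_3[where m = m and n = n and A = A, folded A]
  \<comment> \<open>In these combinations, nonnegativity of the singular values gives both bounds of
    (b), and comparing positions \<open>i\<close> and \<open>i + 1\<close> gives those of
    (c).\<close>
  have d: "S i i 1 + 2 * S i i 2 = ?d i 1" "S i i 1 - S i i 2 = ?d i 2 / 2 + ?d i 3 / 2"
    if "i \<in> {1..min m n}" for i
    unfolding S[OF that] by (simp_all add: field_simps)
  show ?R
  proof (intro conjI ballI)
    fix i assume i: "i \<in> {1..min m n}"
    show "S i i 2 = S i i 3"
      using S[OF i] by simp
    have "?d i k \<ge> 0" for k
      using i by (rule fourier_singular_value_nonneg)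
    from d[OF i] this[of 1] this[of 2] this[of 3]
    show "S i i 1 \<ge> max (- 2 * S i i 2) (S i i 2)"
      by (intro max.boundedI) linarith+
  next
    fix i assume i: "i \<in> {1..min m n - 1}"
    then have i': "i \<in> {1..min m n}" "i + 1 \<in> {1..min m n}"
      by auto
    have "?d (i + 1) k \<le> ?d i k" for k
      using i by (rule fourier_singular_value_antimono)
    from d[OF i'(1)] d[OF i'(2)] this[of 1] this[of 2] this[of 3]
    show "S i i 1 - S (i + 1) (i + 1) 1
        \<ge> max (- 2 * (S i i 2 - S (i + 1) (i + 1) 2)) (S i i 2 - S (i + 1) (i + 1) 2)"
      by (intro max.boundedI; simp only: right_diff_distrib; linarith)
  qed
next
  assume ?R
  then have "kilmer_martin m n 3 S = S"
    by (intro kilmer_martin_3_fixed_point[OF assms(3)]) blast+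
  with assms(3) show ?L
    by (auto simp: s_diagonal_tensors_def f_diagonal_tensors_def)
qed

end
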